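(* Let $X$ be a metrizable topological space, let $\overline{Y}$ be a metrizable compact space and let $Y$ be a nonempty dense subspace of $\overline{Y}$. Let $L$ be a closed nowhere dense subset of $X$, let $\Phi:L\multimap\overline{Y}$ be an upper continuous compact-valued multifunction, and let $D\subseteq X\setminus L$ be such that $L\subseteq\overline{D}$ (closure in $X$). Then there exists a function $f:D\to Y$ (not necessarily continuous) such that $\overline{f}(x)=\Phi(x)$ for every $x\in L$.
   Context: A multifunction $\Phi:L\multimap\overline{Y}$ assigns to each $x\in L$ a nonempty subset $\Phi(x)\subseteq\overline{Y}$ (the notation $\Phi:L\multimap \overline{Y}$ means that the domain $\{x:\Phi(x)\neq\emptyset\}$ is exactly $L$). It is compact-valued if every $\Phi(x)$ is compact. It is upper continuous if for every $x\in L$ and every open set $V\subseteq\overline{Y}$ with $\Phi(x)\subseteq V$ there is a neighborhood $U$ of $x$ in $L$ such that $\Phi(u)\subseteq V$ for all $u\in U$. For $D\subseteq X$ and $f:D\to Y\subseteq\overline{Y}$, the cluster set of $f$ at a point $x\in X$ is $\overline{f}(x)=\bigcap_{U\in\mathcal{U}_x}\overline{f(U\cap D)}$, where $\mathcal{U}_x$ is the collection of all neighborhoods of $x$ in $X$ and the closure of $f(U\cap D)$ is taken in $\overline{Y}$. *)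

theory Defs
  imports "HOL-Analysis.Analysis"
begin

(* Neighbourhoods need not be open. *)
definition neighbourhoods :: "'a topology \<Rightarrow> 'a \<Rightarrow> 'a set set" where
  "neighbourhoods X x = {N. N \<subseteq> topspace X \<and> (\<exists>U. openin X U \<and> x \<in> U \<and> U \<subseteq> N)}"

definition nowhere_dense_in :: "'a topology \<Rightarrow> 'a set \<Rightarrow> bool" where
  "nowhere_dense_in X S \<longleftrightarrow> S \<subseteq> topspace X \<and> X interior_of (X closure_of S) = {}"

(* A multifunction on L is encoded as a total set-valued function; as usual for
   functions on a carrier, its values outside L are irrelevant. *)
definition multifunction_on :: "'a set \<Rightarrow> 'b topology \<Rightarrow> ('a \<Rightarrow> 'b set) \<Rightarrow> bool" where
  "multifunction_on L Z \<Phi> \<longleftrightarrow> (\<forall>x\<in>L. \<Phi> x \<noteq> {} \<and> \<Phi> x \<subseteq> topspace Z)"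

definition compact_valued_on :: "'a set \<Rightarrow> 'b topology \<Rightarrow> ('a \<Rightarrow> 'b set) \<Rightarrow> bool" where
  "compact_valued_on L Z \<Phi> \<longleftrightarrow> (\<forall>x\<in>L. compactin Z (\<Phi> x))"

definition upper_continuous_on ::
    "'a topology \<Rightarrow> 'a set \<Rightarrow> 'b topology \<Rightarrow> ('a \<Rightarrow> 'b set) \<Rightarrow> bool" where
  "upper_continuous_on X L Z \<Phi> \<longleftrightarrow>
     (\<forall>x\<in>L. \<forall>V. openin Z V \<and> \<Phi> x \<subseteq> V \<longrightarrow>
        (\<exists>U \<in> neighbourhoods (subtopology X L) x. \<forall>u\<in>U. \<Phi> u \<subseteq> V))"

definition cluster_set ::
    "'a topology \<Rightarrow> 'b topology \<Rightarrow> 'a set \<Rightarrow> ('a \<Rightarrow> 'b) \<Rightarrow> 'a \<Rightarrow> 'b set" where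
  "cluster_set X Z D f x = (\<Inter>U \<in> neighbourhoods X x. Z closure_of (f ` (U \<inter> D)))"

end

theory Submission
  imports Defs
begin

text \<open>
  It suffices to find \<open>z u \<in> L\<close> and \<open>p u \<in> \<Phi> (z u)\<close> for \<open>u \<in> D\<close> such that \<open>d u (z u)\<close> tends to 0
  as \<open>u\<close> tends to any point of \<open>L\<close>, and such that every point \<open>(x, y)\<close> of the graph of \<open>\<Phi>\<close> is a
  cluster point of the pairs \<open>(u, p u)\<close>. Choosing \<open>f u \<in> Y\<close> within \<open>d u (z u) > 0\<close> of \<open>p u\<close>, upper
  continuity then gives that the cluster set of \<open>f\<close> at \<open>x\<close> is contained in \<open>\<Phi> x\<close>, and clustering of
  the pairs gives the converse inclusion.

  To construct \<open>z\<close> and \<open>p\<close>, enumerate a countable base \<open>W\<close> of the compact space so that each member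
  is met infinitely often. At stage \<open>k\<close>, take a maximal separated net, of mesh tending to 0, in the
  set of all \<open>x \<in> L\<close> for which \<open>\<Phi> x\<close> meets the current \<open>W j\<close>, and move each of its points slightly
  to a point \<open>u\<close> of \<open>D\<close> not used at an earlier stage; these \<open>u\<close> record the net point as \<open>z u\<close> and a
  point of \<open>\<Phi> (z u) \<inter> W j\<close> as \<open>p u\<close>. Fresh points exist because only a uniformly separated set is
  used up at each stage, so the used points do not accumulate at \<open>L\<close>. A point \<open>u\<close> that is never used
  takes an almost nearest point of \<open>L\<close> as \<open>z u\<close>.
\<close>

section \<open>Separated nets and their displacement into \<open>D\<close>\<close>

text \<open>Zorn's lemma gives a maximal \<open>e\<close>-separated subset of \<open>A\<close>. A
  point of \<open>A\<close> at distance at least \<open>e\<close> from all of it could be added, so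
  maximality yields the net property.\<close>

lemma (in Metric_space) maximal_separated_net:
  assumes "A \<subseteq> M" "e > 0"
  obtains Z where "Z \<subseteq> A" "\<And>z w. z \<in> Z \<Longrightarrow> w \<in> Z \<Longrightarrow> z \<noteq> w \<Longrightarrow> e \<le> d z w"
    "\<And>x. x \<in> A \<Longrightarrow> \<exists>z\<in>Z. d x z < e"
proof -
  let ?S = "{Z. Z \<subseteq> A \<and> (\<forall>z\<in>Z. \<forall>w\<in>Z. z \<noteq> w \<longrightarrow> e \<le> d z w)}"
  have "\<exists>Z\<in>?S. \<forall>X\<in>?S. Z \<subseteq> X \<longrightarrow> X = Z"
  proof (rule subset_Zorn')
    fix C assume C: "subset.chain ?S C"
    have "e \<le> d z w" if zw: "z \<in> \<Union>C" "w \<in> \<Union>C" "z \<noteq> w" for z w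
    proof -
      obtain U V where UV: "U \<in> C" "V \<in> C" "z \<in> U" "w \<in> V" using zw by blast
      then have "U \<subseteq> V \<or> V \<subseteq> U" using C by (auto simp: subset_chain_def)
      moreover have "U \<in> ?S" "V \<in> ?S" using C UV by (auto simp: subset_chain_def)
      ultimately show ?thesis using UV zw(3) by blast
    qed
    moreover have "\<Union>C \<subseteq> A" using C by (auto simp: subset_chain_def)
    ultimately show "\<Union>C \<in> ?S" by blast
  qed
  then obtain Z where Z: "Z \<in> ?S" and max: "\<forall>X\<in>?S. Z \<subseteq> X \<longrightarrow> X = Z" by (rule bexE)
  have "\<exists>z\<in>Z. d x z < e" if x: "x \<in> A" for x
  proof (rule ccontr)
    assume "\<not> (\<exists>z\<in>Z. d x z < e)"
    then have far: "e \<le> d x z" "e \<le> d z x" if "z \<in> Z" for z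
      using that by (auto simp: commute not_less)
    have "insert x Z \<in> ?S" using Z x far by auto
    then have "insert x Z = Z" using max[THEN bspec] by (meson subset_insertI)
    then have "x \<in> Z" by blast
    then show False using far(1)[of x] \<open>e > 0\<close> assms(1) x by auto
  qed
  with Z show ?thesis by (intro that[of Z]) auto
qed

text \<open>Each point of an \<open>e\<close>-separated net in \<open>A\<close> is moved by less
  than \<open>e/3\<close> into \<open>D - B\<close>. Two moved points within \<open>e/6\<close> of
  the same \<open>x\<close> would come from net points closer than \<open>e\<close>, so at most one
  lies that near. Since \<open>L\<close> and \<open>D\<close> are disjoint, the enlarged set keeps a
  positive distance from each point of \<open>L\<close>, which permits the next extension.\<close>

lemma (in Metric_space) extend_by_fresh_net:
  assumes "L \<subseteq> M" "D \<subseteq> M" "L \<inter> D = {}" "L \<subseteq> mtopology closure_of D"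
    and "A \<subseteq> L" "e > 0"
    and B: "B \<subseteq> D" "\<And>x. x \<in> L \<Longrightarrow> \<exists>\<delta>>0. \<forall>u\<in>B. \<delta> \<le> d x u"
  shows "\<exists>B'. B \<subseteq> B' \<and> B' \<subseteq> D \<and> (\<forall>x\<in>L. \<exists>\<delta>>0. \<forall>u\<in>B'. \<delta> \<le> d x u) \<and>
    (\<forall>u\<in>B'-B. \<exists>w\<in>A. d u w < e) \<and> (\<forall>x\<in>A. \<exists>u\<in>B'-B. d x u < 2 * e)"
proof -
  have "A \<subseteq> M" using assms by blast
  then obtain Z where Z: "Z \<subseteq> A" and sep: "\<And>z w. z \<in> Z \<Longrightarrow> w \<in> Z \<Longrightarrow> z \<noteq> w \<Longrightarrow> e \<le> d z w"
    and net: "\<And>x. x \<in> A \<Longrightarrow> \<exists>z\<in>Z. d x z < e"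
    using maximal_separated_net[of A e] \<open>e > 0\<close> by blast
  have "\<exists>u\<in>D-B. d z u < e/3" if "z \<in> Z" for z
  proof -
    have zL: "z \<in> L" using that Z assms by blast
    obtain \<delta> where \<delta>: "\<delta> > 0" "\<forall>u\<in>B. \<delta> \<le> d z u" using B(2)[OF zL] by blast
    have "z \<in> mtopology closure_of D" using zL assms by blast
    \<comment> \<open>\<open>\<delta>\<close> keeps the chosen point outside \<open>B\<close>;
      \<open>e/3\<close> bounds the displacement.\<close>
    moreover have "min \<delta> (e/3) > 0" using \<delta> \<open>e > 0\<close> by auto
    ultimately have "\<exists>u\<in>D. u \<in> mball z (min \<delta> (e/3))" unfolding metric_closure_of by blast
    then show ?thesis using \<delta> by force
  qed
  then obtain c where c: "\<And>z. z \<in> Z \<Longrightarrow> c z \<in> D - B" "\<And>z. z \<in> Z \<Longrightarrow> d z (c z) < e/3"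
    by metis
  have avoid: "\<exists>\<delta>>0. \<forall>u\<in>B \<union> c ` Z. \<delta> \<le> d x u" if x: "x \<in> L" for x
  proof -
    have uniq: "z = w" if zw: "z \<in> Z" "w \<in> Z" "d x (c z) < e/6" "d x (c w) < e/6" for z w
    proof (rule ccontr)
      assume ne: "z \<noteq> w"
      have M: "z \<in> M" "w \<in> M" "x \<in> M" "c z \<in> M" "c w \<in> M" using zw x c(1) Z assms by auto
      have "d z w \<le> d z (c z) + d (c z) x + d x (c w) + d (c w) w"
        using M triangle[of z "c z" w] triangle[of "c z" x w] triangle[of x "c w" w] by linarith
      then show False using sep[OF zw(1,2) ne] c(2)[OF zw(1)] c(2)[OF zw(2)] zw(3,4)
        by (simp add: commute)
    qed
    obtain \<delta>1 where \<delta>1: "\<delta>1 > 0" "\<forall>u\<in>B. \<delta>1 \<le> d x u" using B(2)[OF x] by blast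
    have "\<exists>\<delta>2>0. \<forall>z\<in>Z. \<delta>2 \<le> d x (c z)"
    proof (cases "\<exists>z\<in>Z. d x (c z) < e/6")
      case True
      then obtain z where z: "z \<in> Z" "d x (c z) < e/6" by blast
      have "c z \<in> D" using c z by blast
      then have "c z \<in> M" "x \<in> M" "x \<noteq> c z" using x assms by auto
      then have pos: "d x (c z) > 0" by simp
      \<comment> \<open>All other moved points are at least \<open>e/6\<close> away from
        \<open>x\<close>, so this positive distance serves as \<open>\<delta>2\<close>.\<close>
      have "d x (c z) \<le> d x (c w)" if w: "w \<in> Z" for w
      proof (cases "d x (c w) < e/6")
        case True
        then show ?thesis using uniq[OF z(1) w z(2)] by simp
      qed (use z(2) in simp)
      then show ?thesis using pos by blast
    next
      case False
      then show ?thesis using \<open>e > 0\<close> by (intro exI[of _ "e/6"]) auto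
    qed
    then obtain \<delta>2 where "\<delta>2 > 0" "\<forall>z\<in>Z. \<delta>2 \<le> d x (c z)" by blast
    with \<delta>1 show ?thesis by (intro exI[of _ "min \<delta>1 \<delta>2"]) (auto simp: min_le_iff_disj)
  qed
  have diff: "(B \<union> c ` Z) - B = c ` Z" using c(1) by blast
  have close: "\<exists>w\<in>A. d u w < e" if "u \<in> c ` Z" for u
    using that c(2) Z \<open>e > 0\<close> by (force simp: commute)
  have dense: "\<exists>u\<in>c ` Z. d x u < 2 * e" if x: "x \<in> A" for x
  proof -
    obtain z where z: "z \<in> Z" "d x z < e" using net x by blast
    have "x \<in> M" "z \<in> M" "c z \<in> M" using x z c(1) Z assms by auto
    then have "d x (c z) \<le> d x z + d z (c z)" by (rule triangle)
    then show ?thesis using z c(2)[OF z(1)] \<open>e > 0\<close> by (intro bexI[of _ "c z"]) auto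
  qed
  show ?thesis
    by (rule exI[of _ "B \<union> c ` Z"], unfold diff) (use B(1) c(1) avoid close dense in auto)
qed

text \<open>Dependent choice iterates the extension with mesh \<open>1 / Suc k\<close> at stage
  \<open>k\<close>; the differences \<open>B (Suc k) - B k\<close> are the disjoint batches of fresh
  points.\<close>

lemma (in Metric_space) exists_disjoint_nets:
  fixes A :: "nat \<Rightarrow> 'a set"
  assumes "L \<subseteq> M" "D \<subseteq> M" "L \<inter> D = {}" "L \<subseteq> mtopology closure_of D"
    and A: "\<And>k. A k \<subseteq> L"
  obtains B where "mono B" "\<And>k. B k \<subseteq> D" "B 0 = {}"
    "\<And>k x. x \<in> L \<Longrightarrow> \<exists>\<delta>>0. \<forall>u\<in>B k. \<delta> \<le> d x u"
    "\<And>k u. u \<in> B (Suc k) - B k \<Longrightarrow> \<exists>w\<in>A k. d u w < 1 / Suc k"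
    "\<And>k x. x \<in> A k \<Longrightarrow> \<exists>u\<in>B (Suc k) - B k. d x u < 2 / Suc k"
proof -
  \<comment> \<open>The clause for \<open>k = 0\<close> fixes the empty start, so that every point
    of some \<open>B n\<close> has an entry stage.\<close>
  let ?P = "\<lambda>k B. B \<subseteq> D \<and> (k = 0 \<longrightarrow> B = {}) \<and> (\<forall>x\<in>L. \<exists>\<delta>>0. \<forall>u\<in>B. \<delta> \<le> d x u)"
  let ?Q = "\<lambda>k B B'. B \<subseteq> B' \<and> (\<forall>u\<in>B'-B. \<exists>w\<in>A k. d u w < 1 / Suc k) \<and>
    (\<forall>x\<in>A k. \<exists>u\<in>B'-B. d x u < 2 / Suc k)"
  have "\<exists>B. \<forall>k::nat. ?P k (B k) \<and> ?Q k (B k) (B (Suc k))"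
  proof (rule dependent_nat_choice)
    show "\<exists>B. ?P 0 B" using zero_less_one by (intro exI[of _ "{}"]) blast
  next
    fix B and k :: nat assume "?P k B"
    then have B: "B \<subseteq> D" "\<And>x. x \<in> L \<Longrightarrow> \<exists>\<delta>>0. \<forall>u\<in>B. \<delta> \<le> d x u" by blast+
    have "1 / real (Suc k) > 0" by simp
    from extend_by_fresh_net[OF assms(1-4) A[of k] this B] obtain B' where "B \<subseteq> B'" "B' \<subseteq> D" "\<forall>x\<in>L. \<exists>\<delta>>0. \<forall>u\<in>B'. \<delta> \<le> d x u"
      "\<forall>u\<in>B'-B. \<exists>w\<in>A k. d u w < 1 / Suc k" "\<forall>x\<in>A k. \<exists>u\<in>B'-B. d x u < 2 * (1 / Suc k)"
      by blast
    then show "\<exists>B'. ?P (Suc k) B' \<and> ?Q k B B'"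
      by (intro exI[of _ B']) simp
  qed
  then obtain B where "\<forall>k. ?P k (B k) \<and> ?Q k (B k) (B (Suc k))" by (rule exE)
  note B = this[THEN spec, THEN conjunct1] this[THEN spec, THEN conjunct2]
  show ?thesis
  proof (rule that[of B])
    show "mono B" using B(2) by (simp add: mono_iff_le_Suc)
    show "B 0 = {}" using B(1)[of 0] by simp
    show "B k \<subseteq> D" for k using B(1)[of k] by blast
    show "\<exists>\<delta>>0. \<forall>u\<in>B k. \<delta> \<le> d x u" if "x \<in> L" for k x
      using B(1)[of k] that by blast
    show "\<exists>w\<in>A k. d u w < 1 / Suc k" if "u \<in> B (Suc k) - B k" for k u
      using B(2)[of k] that by blast
    show "\<exists>u\<in>B (Suc k) - B k. d x u < 2 / Suc k" if "x \<in> A k" for k x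
      using B(2)[of k] that by blast
  qed
qed

section \<open>Choice of nearby points of the graph\<close>

text \<open>Closedness of \<open>L\<close> makes the infimum of the distances from \<open>u\<close>
  positive, hence smaller than its double, and some point of \<open>L\<close> is closer than that
  double.\<close>

lemma (in Metric_space) almost_nearest_point:
  assumes "closedin mtopology L" "L \<noteq> {}" "u \<in> M - L"
  obtains z where "z \<in> L" "\<And>x. x \<in> L \<Longrightarrow> d u z \<le> 2 * d u x"
proof -
  have "openin mtopology (M - L)" using assms(1) by (simp add: closedin_def)
  then obtain r where r: "r > 0" "mball u r \<subseteq> M - L" using assms(3) by (auto simp: openin_mtopology)
  have "L \<subseteq> M" using closedin_subset[OF assms(1)] by simp
  then have rL: "r \<le> d u x" if "x \<in> L" for x using that r assms(3) by force
  let ?I = "Inf (d u ` L)"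
  have "r \<le> ?I" using assms(2) rL by (intro cInf_greatest) auto
  then have "?I < 2 * ?I" using r by simp
  moreover have bdd: "bdd_below (d u ` L)" using rL by (rule bdd_belowI2)
  ultimately obtain z where z: "z \<in> L" "d u z < 2 * ?I"
    using cInf_lessD[of "d u ` L" "2 * ?I"] assms(2) by auto
  have "d u z \<le> 2 * d u x" if "x \<in> L" for x
    using cINF_lower[OF bdd that] z(2) by simp
  with z(1) show ?thesis by (rule that)
qed

text \<open>Points of \<open>D\<close> near \<open>x\<close> avoid the early stages: they either
  enter at a late stage, where the mesh is small, or have an almost nearest point as
  \<open>z u\<close>. Each \<open>W j\<close> is treated at arbitrarily late stages, which gives the
  clustering.\<close>

lemma (in Metric_space) exists_graph_selector:
  fixes \<Phi> :: "'a \<Rightarrow> 'b set" and W :: "nat \<Rightarrow> 'b set"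
  assumes L: "closedin mtopology L" "L \<noteq> {}" and D: "D \<subseteq> M - L" "L \<subseteq> mtopology closure_of D"
    and ne: "\<And>x. x \<in> L \<Longrightarrow> \<Phi> x \<noteq> {}"
  obtains z p where "\<And>u. u \<in> D \<Longrightarrow> z u \<in> L" "\<And>u. u \<in> D \<Longrightarrow> p u \<in> \<Phi> (z u)"
    "\<And>x e. x \<in> L \<Longrightarrow> e > 0 \<Longrightarrow> \<exists>\<delta>>0. \<forall>u\<in>D. d x u < \<delta> \<longrightarrow> d u (z u) < e"
    "\<And>x j e. x \<in> L \<Longrightarrow> \<Phi> x \<inter> W j \<noteq> {} \<Longrightarrow> e > 0 \<Longrightarrow> \<exists>u\<in>D. d x u < e \<and> p u \<in> W j"
proof -
  have LM: "L \<subseteq> M" using closedin_subset[OF L(1)] by simp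
  \<comment> \<open>Decoding pairs makes \<open>j\<close> take every value infinitely often.\<close>
  define j :: "nat \<Rightarrow> nat" where "j k = fst (prod_decode k)" for k
  define A where "A k = {x \<in> L. \<Phi> x \<inter> W (j k) \<noteq> {}}" for k
  have "D \<subseteq> M" "L \<inter> D = {}" "\<And>k. A k \<subseteq> L" using D(1) by (auto simp: A_def)
  then obtain B where B: "mono B" "\<And>k. B k \<subseteq> D" "B 0 = {}"
    and avoid: "\<And>k x. x \<in> L \<Longrightarrow> \<exists>\<delta>>0. \<forall>u\<in>B k. \<delta> \<le> d x u"
    and close: "\<And>k u. u \<in> B (Suc k) - B k \<Longrightarrow> \<exists>w\<in>A k. d u w < 1 / Suc k"
    and dense: "\<And>k x. x \<in> A k \<Longrightarrow> \<exists>u\<in>B (Suc k) - B k. d x u < 2 / Suc k"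
    using exists_disjoint_nets[OF LM _ _ D(2)] by metis
  have stage_unique: "k = l" if "u \<in> B (Suc k) - B k" "u \<in> B (Suc l) - B l" for k l u
  proof (rule ccontr)
    assume "k \<noteq> l"
    then have "Suc k \<le> l \<or> Suc l \<le> k" by linarith
    then have "B (Suc k) \<subseteq> B l \<or> B (Suc l) \<subseteq> B k" using monoD[OF B(1)] by blast
    then show False using that by blast
  qed
  have stage: "\<exists>k. u \<in> B (Suc k) - B k" if "u \<in> B n" for u n
    using that B(3) by (induction n) auto
  \<comment> \<open>One existence statement covers both kinds of points, so that \<open>z\<close>
    and \<open>p\<close> are chosen together; by \<open>stage_unique\<close> the condition on
    \<open>k\<close> concerns at most one stage.\<close>
  have "\<exists>z p. z \<in> L \<and> p \<in> \<Phi> z \<and>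
      (\<forall>k. u \<in> B (Suc k) - B k \<longrightarrow> d u z < 1 / Suc k \<and> p \<in> W (j k)) \<and>
      ((\<forall>k. u \<notin> B (Suc k) - B k) \<longrightarrow> (\<forall>x\<in>L. d u z \<le> 2 * d u x))" if u: "u \<in> D" for u
  proof (cases "\<exists>k. u \<in> B (Suc k) - B k")
    case True
    then obtain k where k: "u \<in> B (Suc k) - B k" by blast
    obtain w where w: "w \<in> A k" "d u w < 1 / Suc k" using close[OF k] by blast
    obtain p where "p \<in> \<Phi> w" "p \<in> W (j k)" using w(1) by (auto simp: A_def)
    moreover have "w \<in> L" using w(1) by (simp add: A_def)
    moreover have "l = k" if "u \<in> B (Suc l) - B l" for l using stage_unique[OF that k] .
    ultimately show ?thesis using w(2) k by blast
  next
    case False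
    obtain z where "z \<in> L" "\<And>x. x \<in> L \<Longrightarrow> d u z \<le> 2 * d u x"
      using almost_nearest_point[OF L, of u] u D(1) by blast
    with False ne[of z] show ?thesis by blast
  qed
  then obtain z p where zp: "\<And>u. u \<in> D \<Longrightarrow> z u \<in> L" "\<And>u. u \<in> D \<Longrightarrow> p u \<in> \<Phi> (z u)"
    and used: "\<And>u k. u \<in> D \<Longrightarrow> u \<in> B (Suc k) - B k \<Longrightarrow> d u (z u) < 1 / Suc k \<and> p u \<in> W (j k)"
    and unused: "\<And>u x. u \<in> D \<Longrightarrow> \<forall>k. u \<notin> B (Suc k) - B k \<Longrightarrow> x \<in> L \<Longrightarrow> d u (z u) \<le> 2 * d u x"
    by metis
  show ?thesis
  proof (rule that[OF zp])
    fix x and e :: real assume x: "x \<in> L" and e: "e > 0"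
    \<comment> \<open>From stage \<open>K\<close> on the mesh is below \<open>e\<close>, and
      \<open>\<delta>\<close> excludes points that entered earlier. The bound \<open>e/2\<close>
      below absorbs the factor 2 of almost nearest points.\<close>
    obtain K where K: "1 / Suc K < e" using nat_approx_posE[OF e] by metis
    obtain \<delta> where \<delta>: "\<delta> > 0" "\<forall>u\<in>B K. \<delta> \<le> d x u" using avoid[OF x] by blast
    have "d u (z u) < e" if u: "u \<in> D" "d x u < min \<delta> (e/2)" for u
    proof (cases "\<exists>k. u \<in> B (Suc k) - B k")
      case True
      then obtain k where k: "u \<in> B (Suc k) - B k" by blast
      have "u \<notin> B K" using \<delta>(2) u(2) by force
      then have "\<not> Suc k \<le> K" using k monoD[OF B(1), of "Suc k" K] by blast
      then have "1 / real (Suc k) \<le> 1 / Suc K" by (intro divide_left_mono) auto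
      then show ?thesis using used[OF u(1) k] K by linarith
    next
      case False
      then show ?thesis using unused[OF u(1) _ x] u(2) by (force simp: commute)
    qed
    then show "\<exists>\<delta>>0. \<forall>u\<in>D. d x u < \<delta> \<longrightarrow> d u (z u) < e"
      using \<delta>(1) e by (intro exI[of _ "min \<delta> (e/2)"]) auto
  next
    fix x i and e :: real assume x: "x \<in> L" "\<Phi> x \<inter> W i \<noteq> {}" and e: "e > 0"
    obtain n where n: "1 / Suc n < e / 2" using nat_approx_posE[of "e/2"] e by auto
    \<comment> \<open>This stage treats \<open>W i\<close>, and its number is at least
      \<open>n\<close>, so its mesh is fine enough.\<close>
    let ?k = "prod_encode (i, n)"
    have jk: "j ?k = i" by (simp add: j_def)
    then have "x \<in> A ?k" using x by (simp add: A_def)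
    then obtain u where u: "u \<in> B (Suc ?k) - B ?k" "d x u < 2 / Suc ?k" using dense by blast
    have "2 / real (Suc ?k) \<le> 2 / Suc n"
      using le_prod_encode_2[of n i] by (intro divide_left_mono) auto
    moreover have "2 / real (Suc n) = 2 * (1 / Suc n)" by simp
    ultimately have "d x u < e" using u(2) n by linarith
    moreover have "u \<in> D" using u(1) B(2) by blast
    ultimately show "\<exists>u\<in>D. d x u < e \<and> p u \<in> W i" using used[of u ?k] u(1) jk by auto
  qed
qed

section \<open>A countable base from total boundedness\<close>

text \<open>The balls of radius \<open>1 / Suc n\<close> around finite nets form a countable family.
  One that contains \<open>y\<close> and has radius below \<open>e/2\<close> lies in
  \<open>mball y e\<close>.\<close>

lemma (in Metric_space) mtotally_bounded_countable_base:
  assumes "mtotally_bounded M"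
  obtains W :: "nat \<Rightarrow> 'a set"
  where "\<And>y e. y \<in> M \<Longrightarrow> e > 0 \<Longrightarrow> \<exists>j. y \<in> W j \<and> W j \<subseteq> mball y e"
proof -
  have "\<exists>K. finite K \<and> K \<subseteq> M \<and> M \<subseteq> (\<Union>q\<in>K. mball q (1 / Suc n))" for n
    using assms unfolding mtotally_bounded_def by simp
  then obtain K where K: "\<And>n. finite (K n)" "\<And>n. K n \<subseteq> M"
    "\<And>n. M \<subseteq> (\<Union>q\<in>K n. mball q (1 / Suc n))"
    by metis
  define C where "C = (\<Union>n. (\<lambda>q. mball q (1 / Suc n)) ` K n)"
  have cC: "countable C" unfolding C_def using K(1) by (intro countable_UN) (auto intro: countable_finite)
  have "\<exists>j. y \<in> from_nat_into C j \<and> from_nat_into C j \<subseteq> mball y e" if y: "y \<in> M" and e: "e > 0" for y e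
  proof -
    obtain n where n: "1 / Suc n < e / 2" using nat_approx_posE[of "e/2"] e by auto
    obtain q where q: "q \<in> K n" "y \<in> mball q (1 / Suc n)" using K(3)[of n] y by blast
    have "mball q (1 / Suc n) \<subseteq> mball y e"
    proof
      fix w assume w: "w \<in> mball q (1 / Suc n)"
      then have "d y w \<le> d y q + d q w" using y by (intro triangle) auto
      then show "w \<in> mball y e" using w q(2) n y by (simp add: commute)
    qed
    moreover have "mball q (1 / Suc n) \<in> C" using q(1) by (auto simp: C_def)
    ultimately show ?thesis using from_nat_into_surj[OF cC] q(2) by metis
  qed
  then show ?thesis by (rule that)
qed

section \<open>Metric forms of cluster sets, upper continuity and separation\<close>

lemma (in Metric_space) neighbourhoods_mtopology:
  "x \<in> M \<Longrightarrow> N \<in> neighbourhoods mtopology x \<longleftrightarrow> N \<subseteq> M \<and> (\<exists>r>0. mball x r \<subseteq> N)"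
proof -
  assume x: "x \<in> M"
  have "(\<exists>U. openin mtopology U \<and> x \<in> U \<and> U \<subseteq> N) \<longleftrightarrow> (\<exists>r>0. mball x r \<subseteq> N)"
  proof
    assume "\<exists>U. openin mtopology U \<and> x \<in> U \<and> U \<subseteq> N"
    then show "\<exists>r>0. mball x r \<subseteq> N" unfolding openin_mtopology by (meson order_trans)
  next
    assume "\<exists>r>0. mball x r \<subseteq> N"
    then show "\<exists>U. openin mtopology U \<and> x \<in> U \<and> U \<subseteq> N"
      using x openin_mball centre_in_mball_iff by blast
  qed
  then show ?thesis by (simp add: neighbourhoods_def)
qed

text \<open>A single \<open>e\<close> controls both the distance to \<open>x\<close> and the ball
  around \<open>y\<close>, because the condition at \<open>min r e\<close> implies it for the
  separate radii \<open>r\<close> and \<open>e\<close>.\<close>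

lemma cluster_set_metric:
  assumes "Metric_space M d" "Metric_space N \<rho>" "x \<in> M" "D \<subseteq> M"
  shows "cluster_set (Metric_space.mtopology M d) (Metric_space.mtopology N \<rho>) D f x =
    {y \<in> N. \<forall>e>0. \<exists>u\<in>D. d x u < e \<and> f u \<in> Metric_space.mball N \<rho> y e}" (is "?l = ?r")
proof -
  interpret X: Metric_space M d by fact
  interpret Y: Metric_space N \<rho> by fact
  show ?thesis
  proof (intro equalityI subsetI)
    fix y assume y: "y \<in> ?l"
    have *: "y \<in> Y.mtopology closure_of (f ` (X.mball x r \<inter> D))" if "r > 0" for r
    proof -
      have "X.mball x r \<in> neighbourhoods X.mtopology x"
        unfolding X.neighbourhoods_mtopology[OF assms(3)] using that X.mball_subset_mspace by blast
      then show ?thesis using y unfolding cluster_set_def by blast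
    qed
    have "y \<in> N" using *[OF zero_less_one] by (simp add: Y.metric_closure_of)
    moreover have "\<exists>u\<in>D. d x u < e \<and> f u \<in> Y.mball y e" if e: "e > 0" for e
    proof -
      obtain v where "v \<in> f ` (X.mball x e \<inter> D)" "v \<in> Y.mball y e"
        using *[OF e] e unfolding Y.metric_closure_of by blast
      then show ?thesis by auto
    qed
    ultimately show "y \<in> ?r" by blast
  next
    fix y assume y: "y \<in> ?r"
    have "y \<in> Y.mtopology closure_of (f ` (U \<inter> D))" if U: "U \<in> neighbourhoods X.mtopology x" for U
    proof -
      obtain r where r: "r > 0" "X.mball x r \<subseteq> U"
        using U unfolding X.neighbourhoods_mtopology[OF assms(3)] by blast
      have "\<exists>v\<in>f ` (U \<inter> D). v \<in> Y.mball y e" if e: "e > 0" for e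
      proof -
        have "min r e > 0" using r(1) e by simp
        moreover have "\<forall>e>0. \<exists>u\<in>D. d x u < e \<and> f u \<in> Y.mball y e" using y by blast
        ultimately have "\<exists>u\<in>D. d x u < min r e \<and> f u \<in> Y.mball y (min r e)" by blast
        then obtain u where u: "u \<in> D" "d x u < min r e" "f u \<in> Y.mball y (min r e)"
          by blast
        then have "u \<in> X.mball x r" using assms(3,4) by auto
        then have "u \<in> U" using r(2) by blast
        then show ?thesis using u by auto
      qed
      then show ?thesis using y unfolding Y.metric_closure_of by blast
    qed
    then show "y \<in> ?l" unfolding cluster_set_def by blast
  qed
qed

lemma (in Metric_space) upper_continuous_onD:
  assumes "upper_continuous_on mtopology L Z \<Phi>" "L \<subseteq> M" "x \<in> L" "openin Z V" "\<Phi> x \<subseteq> V"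
  obtains r where "r > 0" "\<And>u. u \<in> L \<Longrightarrow> d x u < r \<Longrightarrow> \<Phi> u \<subseteq> V"
proof -
  obtain U where "U \<in> neighbourhoods (subtopology mtopology L) x" and U: "\<forall>u\<in>U. \<Phi> u \<subseteq> V"
    using assms unfolding upper_continuous_on_def by blast
  then obtain T where T: "openin mtopology T" "x \<in> T" "T \<inter> L \<subseteq> U"
    unfolding neighbourhoods_def openin_subtopology by blast
  then obtain r where r: "r > 0" "mball x r \<subseteq> T" unfolding openin_mtopology by blast
  show ?thesis
  proof (rule that[OF r(1)])
    fix u assume "u \<in> L" "d x u < r"
    moreover from this have "u \<in> mball x r" using assms(2,3) by auto
    ultimately have "u \<in> T \<inter> L" using r(2) by blast
    then show "\<Phi> u \<subseteq> V" using T(3) U by blast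
  qed
qed

text \<open>As \<open>K\<close> is closed, some ball around \<open>y\<close> misses it; the
  complement of the closed ball of half that radius serves as \<open>V\<close>.\<close>

lemma (in Metric_space) compactin_separate_point:
  assumes "compactin mtopology K" "y \<in> M - K"
  obtains r V where "r > 0" "openin mtopology V" "K \<subseteq> V" "\<And>v. v \<in> V \<Longrightarrow> r \<le> d y v"
proof -
  have "closedin mtopology K"
    using assms(1) Hausdorff_space_mtopology compactin_imp_closedin by blast
  then have "openin mtopology (M - K)" by (simp add: closedin_def)
  then obtain r where r: "r > 0" "mball y r \<subseteq> M - K" using assms(2) by (auto simp: openin_mtopology)
  show ?thesis
  proof (rule that[of "r/2" "M - mcball y (r/2)"])
    show "openin mtopology (M - mcball y (r/2))"
      using closedin_mcball by (simp add: closedin_def)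
    show "K \<subseteq> M - mcball y (r/2)"
      using r compactin_subset_topspace[OF assms(1)] by force
  qed (use r assms(2) in auto)
qed

section \<open>Construction of \<open>f\<close> and the two inclusions\<close>

theorem theorem4p3:
  fixes X :: "'a topology" and Ybar :: "'b topology"
    and Y :: "'b set" and L D :: "'a set" and \<Phi> :: "'a \<Rightarrow> 'b set"
  assumes "metrizable_space X"
    and "metrizable_space Ybar" and "compact_space Ybar"
    and "Y \<subseteq> topspace Ybar" and "Y \<noteq> {}" and "Ybar closure_of Y = topspace Ybar"
    and "closedin X L" and "nowhere_dense_in X L"
    and "multifunction_on L Ybar \<Phi>"
    and "upper_continuous_on X L Ybar \<Phi>"
    and "compact_valued_on L Ybar \<Phi>"
    and "D \<subseteq> topspace X - L" and "L \<subseteq> X closure_of D"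
  shows "\<exists>f :: 'a \<Rightarrow> 'b. f ` D \<subseteq> Y \<and> (\<forall>x\<in>L. cluster_set X Ybar D f x = \<Phi> x)"
proof (cases "L = {}")
  \<comment> \<open>The cluster condition is vacuous here, and a constant map serves. The other case
    provides the nonempty \<open>L\<close> that almost nearest points require.\<close>
  case True
  obtain y where "y \<in> Y" using assms(5) by blast
  then show ?thesis using True by (intro exI[of _ "\<lambda>_. y"]) auto
next
  case False
  obtain M d where Md: "Metric_space M d" and X: "X = Metric_space.mtopology M d"
    using assms(1) unfolding metrizable_space_def by blast
  obtain N \<rho> where N\<rho>: "Metric_space N \<rho>" and Z: "Ybar = Metric_space.mtopology N \<rho>"
    using assms(2) unfolding metrizable_space_def by blast
  interpret X: Metric_space M d by fact
  interpret Z: Metric_space N \<rho> by fact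
  have L: "closedin X.mtopology L" "L \<subseteq> M" and D: "D \<subseteq> M - L" "L \<subseteq> X.mtopology closure_of D"
    using assms(7,12,13) closedin_subset[OF assms(7)] X by auto
  have \<Phi>: "\<And>x. x \<in> L \<Longrightarrow> \<Phi> x \<noteq> {}" "\<And>x. x \<in> L \<Longrightarrow> \<Phi> x \<subseteq> N"
    using assms(9) Z by (auto simp: multifunction_on_def)
  have "Z.mtotally_bounded N" using assms(3) Z Z.compact_space_eq_mcomplete_mtotally_bounded by blast
  then obtain W :: "nat \<Rightarrow> 'b set"
    where W: "\<And>y e. y \<in> N \<Longrightarrow> e > 0 \<Longrightarrow> \<exists>j. y \<in> W j \<and> W j \<subseteq> Z.mball y e"
    using Z.mtotally_bounded_countable_base by metis
  obtain z p where zp: "\<And>u. u \<in> D \<Longrightarrow> z u \<in> L" "\<And>u. u \<in> D \<Longrightarrow> p u \<in> \<Phi> (z u)"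
    and near: "\<And>x e. x \<in> L \<Longrightarrow> e > 0 \<Longrightarrow> \<exists>\<delta>>0. \<forall>u\<in>D. d x u < \<delta> \<longrightarrow> d u (z u) < e"
    and meet: "\<And>x j e. x \<in> L \<Longrightarrow> \<Phi> x \<inter> W j \<noteq> {} \<Longrightarrow> e > 0 \<Longrightarrow> \<exists>u\<in>D. d x u < e \<and> p u \<in> W j"
    by (rule X.exists_graph_selector[OF L(1) False D \<Phi>(1), where W = W]) blast+
  have pN: "p u \<in> N" if "u \<in> D" for u using zp[OF that] \<Phi>(2) by blast
  \<comment> \<open>The tolerance is positive because \<open>u\<close> lies outside
    \<open>L\<close>, and it tends to 0 as \<open>u\<close> approaches a point of
    \<open>L\<close>.\<close>
  have "\<exists>y\<in>Y. \<rho> (p u) y < d u (z u)" if u: "u \<in> D" for u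
  proof -
    have "u \<in> M" "z u \<in> M" "u \<noteq> z u" using u zp(1)[OF u] L(2) D(1) by auto
    then have pos: "d u (z u) > 0" by simp
    have "p u \<in> Z.mtopology closure_of Y" using pN[OF u] assms(6) Z by simp
    then have "\<exists>y\<in>Y. y \<in> Z.mball (p u) (d u (z u))"
      using pos unfolding Z.metric_closure_of by blast
    then show ?thesis by auto
  qed
  then obtain f where f: "\<And>u. u \<in> D \<Longrightarrow> f u \<in> Y" "\<And>u. u \<in> D \<Longrightarrow> \<rho> (p u) (f u) < d u (z u)"
    by metis
  have fN: "f u \<in> N" if "u \<in> D" for u using f(1)[OF that] assms(4) Z by auto
  have "cluster_set X Ybar D f x = \<Phi> x" if x: "x \<in> L" for x
  proof -
    have xM: "x \<in> M" using x L(2) by blast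
    have cluster: "cluster_set X Ybar D f x =
        {y \<in> N. \<forall>e>0. \<exists>u\<in>D. d x u < e \<and> f u \<in> Z.mball y e}"
      unfolding X Z using D(1) by (intro cluster_set_metric[OF Md N\<rho> xM]) auto
    \<comment> \<open>If \<open>y\<close> were outside \<open>\<Phi> x\<close>, upper continuity
      would force \<open>p u\<close> into an open set bounded away from \<open>y\<close>, although
      \<open>f u\<close> is close to both \<open>y\<close> and \<open>p u\<close>.\<close>
    have "y \<in> \<Phi> x" if y: "y \<in> N" and lim: "\<And>e. e > 0 \<Longrightarrow> \<exists>u\<in>D. d x u < e \<and> f u \<in> Z.mball y e" for y
    proof (rule ccontr)
      assume "y \<notin> \<Phi> x"
      moreover have "compactin Z.mtopology (\<Phi> x)"
        using assms(11) x Z by (simp add: compact_valued_on_def)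
      ultimately obtain r V where r: "r > 0" and V: "openin Z.mtopology V" "\<Phi> x \<subseteq> V"
        and far: "\<And>v. v \<in> V \<Longrightarrow> r \<le> \<rho> y v"
        using Z.compactin_separate_point y by blast
      obtain s where s: "s > 0" "\<And>u. u \<in> L \<Longrightarrow> d x u < s \<Longrightarrow> \<Phi> u \<subseteq> V"
        using X.upper_continuous_onD[of L Ybar \<Phi> x V] assms(10) L(2) x V X Z by metis
      \<comment> \<open>\<open>s/2\<close> bounds both legs of the path from \<open>x\<close> via
        \<open>u\<close> to \<open>z u\<close>, and \<open>r/2\<close> both legs from
        \<open>y\<close> via \<open>f u\<close> to \<open>p u\<close>.\<close>
      have "min (s/2) (r/2) > 0" using s(1) r by simp
      then obtain \<delta> where \<delta>: "\<delta> > 0" "\<forall>u\<in>D. d x u < \<delta> \<longrightarrow> d u (z u) < min (s/2) (r/2)"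
        using near[OF x] by blast
      have "min \<delta> (min (s/2) (r/2)) > 0" using \<delta>(1) s(1) r by simp
      then obtain u where u: "u \<in> D" "d x u < min \<delta> (min (s/2) (r/2))"
          "f u \<in> Z.mball y (min \<delta> (min (s/2) (r/2)))"
        using lim by blast
      have z: "d u (z u) < s/2" "d u (z u) < r/2" using u(1,2) \<delta>(2) by auto
      have uM: "u \<in> M" "z u \<in> M" using u(1) D(1) zp(1) L(2) by auto
      have "d x (z u) \<le> d x u + d u (z u)" using xM uM by (rule X.triangle)
      then have "d x (z u) < s" using z(1) u(2) by simp
      then have "p u \<in> V" using s(2) zp[OF u(1)] by blast
      then have "r \<le> \<rho> y (p u)" by (rule far)
      also have "\<dots> \<le> \<rho> y (f u) + \<rho> (f u) (p u)" using y fN[OF u(1)] pN[OF u(1)] by (rule Z.triangle)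
      also have "\<dots> < r" using u(3) f(2)[OF u(1)] z(2) by (simp add: Z.commute)
      finally show False by simp
    qed
    \<comment> \<open>A small base set \<open>W j\<close> around \<open>y\<close> meets
      \<open>\<Phi> x\<close>, so it contains \<open>p u\<close> for some \<open>u\<close> near
      \<open>x\<close>; that nearness also puts \<open>f u\<close> close to
      \<open>p u\<close>.\<close>
    moreover have "\<exists>u\<in>D. d x u < e \<and> f u \<in> Z.mball y e" if y: "y \<in> \<Phi> x" and e: "e > 0" for y e
    proof -
      have yN: "y \<in> N" using \<Phi>(2) x y by blast
      obtain j where j: "y \<in> W j" "W j \<subseteq> Z.mball y (e/2)" using W[OF yN, of "e/2"] e by auto
      obtain \<delta> where \<delta>: "\<delta> > 0" "\<forall>u\<in>D. d x u < \<delta> \<longrightarrow> d u (z u) < e/2"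
        using near[OF x, of "e/2"] e by auto
      obtain u where u: "u \<in> D" "d x u < min \<delta> e" "p u \<in> W j"
        using meet[OF x, of j "min \<delta> e"] y j(1) \<delta>(1) e by auto
      have "\<rho> y (p u) < e/2" using u(3) j(2) by auto
      moreover have "\<rho> (p u) (f u) < e/2" using f(2)[OF u(1)] \<delta>(2) u(1,2) by fastforce
      moreover have "\<rho> y (f u) \<le> \<rho> y (p u) + \<rho> (p u) (f u)"
        using yN pN[OF u(1)] fN[OF u(1)] by (rule Z.triangle)
      ultimately have "f u \<in> Z.mball y e" using yN fN[OF u(1)] by simp
      then show ?thesis using u(1,2) by auto
    qed
    ultimately show ?thesis unfolding cluster using \<Phi>(2)[OF x] by blast
  qed
  then show ?thesis using f(1) by blast
qed

end
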